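(* Let $r\geq 3$ be an integer and let $G$ be a finite simple $K_{1,r}$-free graph. If $\delta(G)\geq \left\lfloor\frac{r}{2}\right\rfloor+1$, then $G$ has a $\mathcal{P}_{\geq 3}$-factor.
   Context: All graphs are finite and simple. $\delta(G)$ is the minimum degree of $G$. $K_{1,r}$ denotes the star with one center vertex adjacent to $r$ leaves; $G$ is $K_{1,r}$-free if it contains no induced subgraph isomorphic to $K_{1,r}$. For an integer $k\geq 2$, a $\mathcal{P}_{\geq k}$-factor of $G$ is a spanning subgraph of $G$ every connected component of which is a path with at least $k$ vertices. *)

theory Defs
  imports "Graph_Theory.Graph_Theory"
begin

text \<open>
  A finite simple undirected graph is a digraph satisfying the locale predicate \<open>graph\<close>: finite,
  symmetric, without loops and parallel arcs, so that an undirected edge is a pair of opposite arcs.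
\<close>

text \<open>
  In a symmetric digraph without loops and parallel arcs the out-degree of a vertex is its number of
  neighbours. The value is unspecified if there are no vertices.
\<close>

definition min_degree :: "('a,'b) pre_digraph \<Rightarrow> nat" where
  "min_degree G = Min (out_degree G ` verts G)"

text \<open>
  The predicate \<open>K\<^bsub>1,r\<^esub> H\<close> from the library says that \<open>H\<close> is some copy of the complete bipartite
  graph, so no separate isomorphism is needed.
\<close>

definition star_free :: "nat \<Rightarrow> ('a,'b) pre_digraph \<Rightarrow> bool" where
  "star_free r G \<longleftrightarrow> \<not> (\<exists>H. induced_subgraph H G \<and> K\<^bsub>1,r\<^esub> H)"

definition path_graph :: "('a,'b) pre_digraph \<Rightarrow> bool" where
  "path_graph P \<longleftrightarrow> graph P \<and>
     (\<exists>xs. xs \<noteq> [] \<and> distinct xs \<and> verts P = set xs \<and>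
        arcs_ends P = {(xs ! i, xs ! Suc i) | i. Suc i < length xs}
                    \<union> {(xs ! Suc i, xs ! i) | i. Suc i < length xs})"

text \<open>
  The condition \<open>graph F\<close> makes \<open>F\<close> symmetric, that is, a subgraph in the undirected sense; its
  strongly connected components are then its connected components.
\<close>

definition path_factor :: "nat \<Rightarrow> ('a,'b) pre_digraph \<Rightarrow> ('a,'b) pre_digraph \<Rightarrow> bool" where
  "path_factor k G F \<longleftrightarrow> graph F \<and> spanning F G \<and>
     (\<forall>C \<in> pre_digraph.sccs F. path_graph C \<and> card (verts C) \<ge> k)"

end

theory Submission
  imports Defs
begin

text \<open>
  Let \<open>f = r div 2\<close>. Take a partition of the vertices into paths with as few short paths (fewer than
  three vertices) as possible and suppose that one is short. Grow an alternating structure from it: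
  a set \<open>S\<close> of centers together with \<open>2 * card S + 1\<close> disjoint items, each a path on one or two
  vertices, such that any single item can be left over while everything else in the structure is
  covered by long paths. If the first vertex of an item \<open>a\<close> has a neighbour \<open>w\<close> outside the structure,
  then attaching \<open>a\<close> at \<open>w\<close> saves a short path unless \<open>w\<close> splits its path into two arms with at most
  two vertices each; in this case \<open>w\<close> becomes a center and the arms become items. The exception is
  the blossom: \<open>a = [z, z']\<close> and \<open>z\<close> is adjacent to both inner vertices of a path \<open>[x, w, v, y]\<close>.
  Then \<open>z\<close> becomes the center and \<open>[z']\<close>, \<open>[x, w]\<close>, \<open>[y, v]\<close> are the items that replace \<open>a\<close>.

  In a maximal structure the first vertices of the items are independent, and all their neighbours
  are centers, except for at most one mate inside the item. So each of them has at least \<open>f\<close>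
  neighbours in \<open>S\<close>, while star-freeness allows each center at most \<open>r - 1 \<le> 2 * f\<close> of them. This
  contradicts \<open>(2 * card S + 1) * f > card S * (2 * f)\<close>.
\<close>

section \<open>Path partitions\<close>

locale simple_graph =
  fixes V :: "'a set" and adj :: "'a \<Rightarrow> 'a \<Rightarrow> bool"
  assumes finite_V: "finite V"
    and adj_sym: "adj u v \<Longrightarrow> adj v u"
begin

definition vpath :: "'a list \<Rightarrow> bool" where
  "vpath p \<longleftrightarrow> p \<noteq> [] \<and> distinct p \<and> successively adj p"

definition path_partition :: "'a list set \<Rightarrow> 'a set \<Rightarrow> bool" where
  "path_partition F X \<longleftrightarrow> finite F \<and> (\<forall>p\<in>F. vpath p) \<and>
     (\<forall>p\<in>F. \<forall>q\<in>F. p \<noteq> q \<longrightarrow> set p \<inter> set q = {}) \<and> \<Union>(set ` F) = X"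

definition num_short :: "'a list set \<Rightarrow> nat" where
  "num_short F = card {p\<in>F. length p < 3}"

text \<open>The count is only bounded from above, so that covers of disjoint sets combine by adding
  their bounds. For \<open>n = 0\<close> every path of the cover is long.\<close>

definition coverable :: "'a set \<Rightarrow> nat \<Rightarrow> bool" where
  "coverable X n \<longleftrightarrow> (\<exists>F. path_partition F X \<and> num_short F \<le> n)"

text \<open>
  Two vertices have to remain on the path because the blossom step cuts off the first vertex of \<open>b\<close>,
  after which the rest must still be long.
\<close>

definition end_segment :: "'a list \<Rightarrow> 'a set \<Rightarrow> bool" where
  "end_segment b X \<longleftrightarrow> (\<exists>q. vpath (b @ q) \<and> 2 \<le> length q \<and> set (b @ q) \<subseteq> X \<and>
     coverable (X - set (b @ q)) 0)"

text \<open>The configuration of the blossom step. One-vertex items are left out because such a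
  vertex can simply be inserted between \<open>w\<close> and \<open>v\<close>. The property cannot
  arise when paths are removed from \<open>F\<close>.\<close>

definition flippable :: "'a list \<Rightarrow> 'a list set \<Rightarrow> bool" where
  "flippable a F \<longleftrightarrow> length a = 2 \<and> (\<exists>x w v y. [x, w, v, y] \<in> F \<and> adj (hd a) w \<and> adj (hd a) v)"

lemma vpath_rev: "vpath (rev p) \<longleftrightarrow> vpath p"
  using adj_sym by (auto simp: vpath_def intro: successively_mono)

lemma vpath_append:
  assumes "vpath p" "vpath q" "set p \<inter> set q = {}" "adj (last p) (hd q)"
  shows "vpath (p @ q)"
  using assms by (auto simp: vpath_def successively_append_iff)

lemma vpath_appendD:
  assumes "vpath (p @ q)"
  shows "p \<noteq> [] \<Longrightarrow> vpath p" "q \<noteq> [] \<Longrightarrow> vpath q" "set p \<inter> set q = {}"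
  using assms by (auto simp: vpath_def successively_append_iff)

section \<open>Combining and splitting path partitions\<close>

lemma path_partition_Un:
  assumes "path_partition F X" "path_partition H Y" "X \<inter> Y = {}"
  shows "path_partition (F \<union> H) (X \<union> Y)" "num_short (F \<union> H) \<le> num_short F + num_short H"
proof -
  have "set p \<inter> set q = {}" "set q \<inter> set p = {}" if "p \<in> F" "q \<in> H" for p q
    using that assms unfolding path_partition_def by blast+
  then show "path_partition (F \<union> H) (X \<union> Y)"
    using assms unfolding path_partition_def by (simp add: ball_Un)
  have "{p \<in> F \<union> H. length p < 3} = {p \<in> F. length p < 3} \<union> {p \<in> H. length p < 3}"
    by auto
  then show "num_short (F \<union> H) \<le> num_short F + num_short H"
    unfolding num_short_def by (simp add: card_Un_le)
qed

lemma path_partition_remove: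
  assumes "path_partition F X" "p \<in> F"
  shows "path_partition (F - {p}) (X - set p)"
    "num_short F = num_short (F - {p}) + (if length p < 3 then 1 else 0)"
proof -
  show "path_partition (F - {p}) (X - set p)"
    using assms unfolding path_partition_def by blast
  have fin: "finite {q \<in> F. length q < 3}"
    using assms unfolding path_partition_def by simp
  have "{q \<in> F - {p}. length q < 3} = {q \<in> F. length q < 3} - {p}" by auto
  then show "num_short F = num_short (F - {p}) + (if length p < 3 then 1 else 0)"
    using fin assms(2) card_Suc_Diff1[OF fin, of p] unfolding num_short_def by auto
qed

lemma path_partition_single: "vpath p \<Longrightarrow> path_partition {p} (set p)"
  by (simp add: path_partition_def)

lemma num_short_single: "num_short {p} = (if length p < 3 then 1 else 0)"
proof -
  have "{q \<in> {p}. length q < 3} = (if length p < 3 then {p} else {})" by auto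
  then show ?thesis by (simp add: num_short_def)
qed

lemma coverable_empty: "coverable {} 0"
  unfolding coverable_def by (rule exI[of _ "{}"]) (simp add: path_partition_def num_short_def)

lemma coverable_Un: "coverable X n \<Longrightarrow> coverable Y m \<Longrightarrow> X \<inter> Y = {} \<Longrightarrow> coverable (X \<union> Y) (n + m)"
  unfolding coverable_def using path_partition_Un by (meson add_mono le_trans)

lemma coverable_add:
  assumes "coverable X n" "vpath p" "set p \<inter> X = {}" "Y = X \<union> set p"
    and "n + (if length p < 3 then 1 else 0) \<le> m"
  shows "coverable Y m"
proof -
  have "coverable (set p) (if length p < 3 then 1 else 0)"
    unfolding coverable_def using path_partition_single[OF assms(2)] num_short_single[of p] by (intro exI[of _ "{p}"]) simp
  from coverable_Un[OF assms(1) this] have "coverable Y (n + (if length p < 3 then 1 else 0))"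
    using assms(3,4) by (simp add: Int_commute)
  then show ?thesis using assms(5) unfolding coverable_def by (meson le_trans)
qed

lemma coverable_add_long:
  assumes "coverable X 0" "vpath p" "set p \<inter> X = {}" "Y = X \<union> set p" "3 \<le> length p"
  shows "coverable Y 0"
  using coverable_add[OF assms(1-4)] assms(5) by simp

lemma end_segmentI:
  assumes "vpath (b @ q)" "2 \<le> length q" "coverable Y 0" "set (b @ q) \<inter> Y = {}" "X = Y \<union> set (b @ q)"
  shows "end_segment b X"
proof -
  have "X - set (b @ q) = Y" using assms by blast
  then show ?thesis using assms unfolding end_segment_def by blast
qed

lemma end_segment_add:
  assumes "end_segment b X" "coverable Y 0" "X \<inter> Y = {}" "Z = X \<union> Y"
  shows "end_segment b Z"
proof -
  obtain q where q: "vpath (b @ q)" "2 \<le> length q" "set (b @ q) \<subseteq> X" "coverable (X - set (b @ q)) 0"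
    using assms(1) unfolding end_segment_def by blast
  have "coverable ((X - set (b @ q)) \<union> Y) 0" using coverable_Un[OF q(4) assms(2)] assms(3) by auto
  then show ?thesis by (rule end_segmentI[OF q(1,2)]) (use q(3) assms in auto)
qed

lemma coverable_single: "vpath p \<Longrightarrow> 3 \<le> length p \<Longrightarrow> coverable (set p) 0"
  using coverable_add_long[OF coverable_empty] by simp

end

section \<open>Alternating structures\<close>

text \<open>
  \<open>F\<close> covers the vertices outside \<open>R\<close> and has fewer short paths than any partition of \<open>V\<close>;
  hence \<open>R\<close> itself cannot be covered by long paths. Blossoms can only be handled at items from
  which nothing has been grown; such an item is an end segment after the removal of any other item.
\<close>

locale alternating_structure = simple_graph V adj
  for V :: "'a set" and adj :: "'a \<Rightarrow> 'a \<Rightarrow> bool" +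
  fixes R :: "'a set" and I :: "'a list set" and S :: "'a set" and F :: "'a list set"
  assumes R_subset: "R \<subseteq> V"
    and item_path: "a \<in> I \<Longrightarrow> vpath a"
    and item_length: "a \<in> I \<Longrightarrow> length a \<le> 2"
    and item_disjoint: "a \<in> I \<Longrightarrow> b \<in> I \<Longrightarrow> a \<noteq> b \<Longrightarrow> set a \<inter> set b = {}"
    and R_eq: "R = S \<union> \<Union>(set ` I)"
    and centers_disjoint: "S \<inter> \<Union>(set ` I) = {}"
    and card_items: "card I = 2 * card S + 1"
    and part: "path_partition F (V - R)"
    and optimal: "\<not> coverable V (num_short F)"
    and coverable_without: "a \<in> I \<Longrightarrow> coverable (R - set a) 0"
    and end_segments: "a \<in> I \<Longrightarrow> b \<in> I \<Longrightarrow> a \<noteq> b \<Longrightarrow>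
      end_segment b (R - set a) \<or> end_segment a (R - set b)"
    and head_adj: "a \<in> I \<Longrightarrow> w \<in> R \<Longrightarrow> adj (hd a) w \<Longrightarrow> w \<in> S \<union> set a"
    and leaf_or_not_flippable: "a \<in> I \<Longrightarrow>
      (\<forall>b \<in> I - {a}. end_segment a (R - set b)) \<or> \<not> flippable a F"
begin

section \<open>Consequences of optimality\<close>

text \<open>Together with the remaining paths of \<open>F\<close>, such a cover would partition
  \<open>V\<close> with at most \<open>num_short F\<close> short paths. If \<open>p\<close> itself
  is short, its removal saves one, so one short path may be spent.\<close>

lemma not_coverable_R_Un:
  assumes "p \<in> F" "m \<le> (if length p < 3 then 1 else 0)"
  shows "\<not> coverable (R \<union> set p) m"
proof
  assume c: "coverable (R \<union> set p) m"
  note rem = path_partition_remove[OF part assms(1)]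
  have "coverable (V - R - set p) (num_short (F - {p}))" using rem(1) unfolding coverable_def by blast
  from coverable_Un[OF c this] have "coverable ((R \<union> set p) \<union> (V - R - set p)) (m + num_short (F - {p}))"
    by blast
  moreover have "set p \<subseteq> V" using part assms(1) unfolding path_partition_def by blast
  then have "(R \<union> set p) \<union> (V - R - set p) = V" using R_subset by blast
  ultimately have "coverable V (m + num_short (F - {p}))" by simp
  moreover have "m + num_short (F - {p}) \<le> num_short F" using rem(2) assms(2) by simp
  ultimately have "coverable V (num_short F)" unfolding coverable_def by (meson le_trans)
  then show False using optimal by simp
qed

lemma F_path: "p \<in> F \<Longrightarrow> vpath p"
  using part unfolding path_partition_def by blast

lemma F_disjoint: "p \<in> F \<Longrightarrow> set p \<inter> R = {}" "p \<in> F \<Longrightarrow> set p \<subseteq> V"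
  using part unfolding path_partition_def by blast+

lemma item_subset: "a \<in> I \<Longrightarrow> set a \<subseteq> R"
  using R_eq by blast

lemma finite_items: "finite I"
  using card_items card.infinite by fastforce

lemma finite_centers: "finite S"
  using R_eq R_subset finite_V by (meson Un_upper1 finite_subset)

section \<open>Attaching an item at an outside vertex\<close>

text \<open>\<open>l\<close> and \<open>r\<close> are the two arms at \<open>w\<close>, both read
  outwards from \<open>w\<close>. Only the vertex set and the length of \<open>p\<close> are
  compared, so the arms can be exchanged.\<close>

definition attachable :: "'a list \<Rightarrow> 'a list \<Rightarrow> 'a list \<Rightarrow> 'a \<Rightarrow> 'a list \<Rightarrow> bool" where
  "attachable a p l w r \<longleftrightarrow> a \<in> I \<and> p \<in> F \<and> set p = set (rev l @ w # r) \<and>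
     length p = length (rev l @ w # r) \<and> vpath (rev l @ w # r) \<and> adj (hd a) w"

lemma attachable_sym: "attachable a p l w r \<Longrightarrow> attachable a p r w l"
  using vpath_rev[of "rev l @ w # r"] unfolding attachable_def by auto

lemma attachableD:
  assumes "attachable a p l w r"
  shows "a \<in> I" "p \<in> F" "set a \<subseteq> R" "set p = set l \<union> {w} \<union> set r"
    "set l \<inter> R = {}" "set r \<inter> R = {}" "w \<notin> R" "w \<notin> set l" "w \<notin> set r" "set l \<inter> set r = {}"
    "length p = length l + length r + 1"
    "vpath (rev l @ w # r)" "vpath (w # r)" "vpath (w # l)" "l \<noteq> [] \<Longrightarrow> vpath l" "r \<noteq> [] \<Longrightarrow> vpath r"
    "vpath (rev a @ w # r)" "a \<noteq> []" "vpath a" "length a \<le> 2"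
proof -
  show base: "a \<in> I" "p \<in> F" "set p = set l \<union> {w} \<union> set r"
    "length p = length l + length r + 1" "vpath (rev l @ w # r)"
    using assms unfolding attachable_def by auto
  show aR: "set a \<subseteq> R" using base(1) by (rule item_subset)
  have disj: "set p \<inter> R = {}" using F_disjoint(1)[OF base(2)] .
  then show "set l \<inter> R = {}" "set r \<inter> R = {}" "w \<notin> R" using base(3) by auto
  show "w \<notin> set l" "w \<notin> set r" "set l \<inter> set r = {}"
    using base(5) unfolding vpath_def by auto
  show wr: "vpath (w # r)" and "r \<noteq> [] \<Longrightarrow> vpath r"
    using base(5) by (auto simp: vpath_def successively_append_iff successively_Cons)
  have "vpath (rev r @ w # l)" using vpath_rev[of "rev l @ w # r"] base(5) by simp
  then show "vpath (w # l)" and "l \<noteq> [] \<Longrightarrow> vpath l"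
    by (auto simp: vpath_def successively_append_iff successively_Cons)
  show a: "vpath a" "length a \<le> 2" using item_path item_length base(1) by auto
  then show "a \<noteq> []" unfolding vpath_def by simp
  then show "vpath (rev a @ w # r)"
    using assms a wr aR disj base(3) unfolding attachable_def
    by (intro vpath_append) (auto simp: vpath_rev last_rev)
qed

text \<open>If \<open>l\<close> is empty, or \<open>l\<close> is long and \<open>r\<close> is empty,
  then \<open>w\<close> is an end of the path and \<open>a\<close> can be prolonged along all of it.
  If \<open>l\<close> is long and \<open>r\<close> nonempty, then \<open>l\<close> becomes a path of
  its own and \<open>a\<close> continues through \<open>w\<close> into \<open>r\<close>. Either way
  \<open>a\<close> is absorbed, against optimality.\<close>

lemma arm_short:
  assumes "attachable a p l w r"
  shows "l \<noteq> [] \<and> length l \<le> 2"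
proof (rule ccontr)
  note D = attachableD[OF assms] and D' = attachableD[OF attachable_sym[OF assms]]
  assume "\<not> (l \<noteq> [] \<and> length l \<le> 2)"
  then consider "l = []" | "length l \<ge> 3" "r = []" | "length l \<ge> 3" "r \<noteq> []" by force
  then show False
  proof cases
    case 1
    have "coverable (R \<union> set p) (if length p < 3 then 1 else 0)"
      by (rule coverable_add[OF coverable_without[OF D(1)] D(17)]) (use D 1 in auto)
    then show ?thesis using not_coverable_R_Un[OF D(2)] by blast
  next
    case 2
    have "coverable (R \<union> set p) 0"
      by (rule coverable_add_long[OF coverable_without[OF D(1)] D'(17)]) (use D 2 in auto)
    then show ?thesis using not_coverable_R_Un[OF D(2)] by blast
  next
    case 3
    have "coverable (R \<union> {w} \<union> set r) 0"
    proof (rule coverable_add_long[OF coverable_without[OF D(1)] D(17)])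
      show "3 \<le> length (rev a @ w # r)" using 3 D(18) by (cases a; cases r) auto
    qed (use D in auto)
    moreover have "vpath l" using 3 by (intro D(15)) auto
    ultimately have "coverable (R \<union> set p) 0"
      by (rule coverable_add_long) (use D(4-10) 3 in auto)
    then show ?thesis using not_coverable_R_Un[OF D(2)] by blast
  qed
qed

section \<open>Turning a vertex of a path of \<open>F\<close> into a center\<close>

text \<open>Here \<open>p\<close> is fixed as a list up to reversal, because
  \<open>flippable\<close> asks whether a particular list belongs to \<open>F\<close>.\<close>

definition growable :: "'a list \<Rightarrow> 'a list \<Rightarrow> 'a list \<Rightarrow> 'a \<Rightarrow> 'a list \<Rightarrow> bool" where
  "growable a p l w r \<longleftrightarrow> attachable a p l w r \<and> \<not> flippable a F \<and>
     (p = rev l @ w # r \<or> p = rev r @ w # l)"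

lemma growable_sym: "growable a p l w r \<Longrightarrow> growable a p r w l"
  unfolding growable_def using attachable_sym by blast

lemma growableD:
  assumes "growable a p l w r"
  shows "attachable a p l w r" "l \<noteq> []" "r \<noteq> []" "length l \<le> 2" "length r \<le> 2"
    "3 \<le> length (rev a @ w # r)" "3 \<le> length (rev l @ w # r)" "\<not> flippable a F"
proof -
  show att: "attachable a p l w r" "\<not> flippable a F" using assms unfolding growable_def by auto
  show l: "l \<noteq> []" "length l \<le> 2" using arm_short[OF att(1)] by auto
  show r: "r \<noteq> []" "length r \<le> 2" using arm_short[OF attachable_sym[OF att(1)]] by auto
  show "3 \<le> length (rev a @ w # r)" "3 \<le> length (rev l @ w # r)"
    using l r attachableD(18)[OF att(1)] by (cases a; cases l; cases r; auto)+
qed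

lemma not_coverable_growable:
  assumes "growable a p l w r"
  shows "\<not> coverable (R \<union> set p) 0"
  using not_coverable_R_Un attachableD(2)[OF growableD(1)[OF assms]] by blast

lemma coverable_without_arm:
  assumes "growable a p l w r"
  shows "coverable (R \<union> set p - set l) 0"
  using attachableD[OF growableD(1)[OF assms]] growableD(6)[OF assms]
  by (intro coverable_add_long[OF coverable_without[of a], of "rev a @ w # r"]) auto

lemma end_segment_arm_item:
  assumes "growable a p l w r" "d \<in> I"
  shows "end_segment (rev l) (R \<union> set p - set d)"
  using attachableD[OF growableD(1)[OF assms(1)]] growableD[OF assms(1)] item_subset[OF assms(2)]
  by (intro end_segmentI[of "rev l" "w # r" "R - set d", OF _ _ coverable_without[OF assms(2)]])
     (auto simp: Suc_le_eq)

text \<open>When \<open>r\<close> is left over, \<open>rev l\<close> runs on through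
  \<open>w\<close> into \<open>a\<close>; these provide the two further vertices.\<close>

lemma end_segment_arms:
  assumes "growable a p l w r"
  shows "end_segment (rev l) (R \<union> set p - set r)"
proof -
  note D = attachableD[OF growableD(1)[OF assms]] and G = growableD[OF assms]
  have "vpath (rev l @ w # a)"
    using attachableD(17)[OF attachable_sym[OF G(1)]] vpath_rev[of "rev l @ w # a"] by simp
  then show ?thesis
    by (rule end_segmentI[OF _ _ coverable_without[OF D(1)]]) (use D in \<open>auto simp: Suc_le_eq\<close>)
qed

lemma end_segment_add_path:
  assumes "growable a p l w r" "d \<in> I" "end_segment b (R - set d)"
  shows "end_segment b (R \<union> set p - set d)"
proof (rule end_segment_add[OF assms(3)])
  note D = attachableD[OF growableD(1)[OF assms(1)]]
  show "coverable (set p) 0" using F_path[OF D(2)] coverable_single growableD(7)[OF assms(1)] D(11) by simp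
qed (use F_disjoint(1)[OF attachableD(2)[OF growableD(1)[OF assms(1)]]] item_subset[OF assms(2)] in auto)

text \<open>With the arm \<open>l\<close> left over, the rest of \<open>p\<close> takes up
  \<open>a\<close>, so that inside \<open>R\<close> the situation is the one in which
  \<open>a\<close> is left over.\<close>

lemma end_segment_without_arm:
  assumes "growable a p l w r" "end_segment b (R - set a)"
  shows "end_segment b (R \<union> set p - set l)"
proof (rule end_segment_add[OF assms(2)])
  note D = attachableD[OF growableD(1)[OF assms(1)]]
  show "coverable (set (rev a @ w # r)) 0" by (rule coverable_single[OF D(17) growableD(6)[OF assms(1)]])
qed (use attachableD[OF growableD(1)[OF assms(1)]] in auto)

text \<open>An item has at most two vertices, so each of them is an end of the item and
  \<open>q\<close> can be joined to it there.\<close>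

lemma coverable_item_extend:
  assumes "b \<in> I" "u \<in> set b" "vpath q" "adj u (hd q)" "2 \<le> length q" "coverable Y 0"
    and "set b \<inter> set q = {}" "(set b \<union> set q) \<inter> Y = {}" "Z = Y \<union> set b \<union> set q"
  shows "coverable Z 0"
proof -
  have b: "vpath b" "b \<noteq> []" using item_path[OF assms(1)] unfolding vpath_def by auto
  have "u = hd b \<or> u = last b"
    using assms(2) item_length[OF assms(1)] by (cases b; cases "tl b") auto
  then obtain c where c: "vpath c" "set c = set b" "last c = u" "c \<noteq> []"
    using b vpath_rev[of b] by (metis last_rev set_rev rev_is_Nil_conv)
  have "vpath (c @ q)" using c assms by (intro vpath_append) auto
  moreover have "3 \<le> length (c @ q)" using c(4) assms(5) by (cases c) auto
  ultimately show ?thesis by (intro coverable_add_long[OF assms(6)]) (use c assms in auto)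
qed

lemma coverable_link_item:
  assumes "p \<in> F" "b \<in> I" "u \<in> set b" "vpath q" "set q = set p" "adj u (hd q)" "2 \<le> length q"
  shows "coverable (R \<union> set p) 0"
  by (rule coverable_item_extend[OF assms(2,3,4,6,7) coverable_without[OF assms(2)]])
    (use F_disjoint(1)[OF assms(1)] item_subset[OF assms(2)] assms(5) in auto)

text \<open>Such an edge would let \<open>R\<close> and \<open>p\<close> be covered by long paths.
  If \<open>y\<close> is an end of \<open>p\<close>, then \<open>d\<close> and \<open>p\<close> are
  linked directly. Otherwise \<open>l = [y, e]\<close>, and for \<open>d\<close> other than
  \<open>a\<close> the item \<open>d\<close> absorbs \<open>y, e\<close> while \<open>a\<close>
  absorbs \<open>w\<close> and \<open>r\<close>; \<open>end_segments\<close> tells which of the two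
  items brings a longer path along.\<close>

lemma old_head_arm_not_adj:
  assumes "growable a p l w r" "d \<in> I" "y \<in> set l"
  shows "\<not> adj (hd d) y"
proof
  assume adj: "adj (hd d) y"
  note D = attachableD[OF growableD(1)[OF assms(1)]] and G = growableD[OF assms(1)]
  note no = not_coverable_growable[OF assms(1)]
  have d: "vpath d" "d \<noteq> []" "set d \<subseteq> R" "length d \<le> 2"
    using item_path item_subset item_length assms(2) unfolding vpath_def by auto
  show False
  proof (cases "y = last l")
    case True
    then show ?thesis
      using coverable_link_item[OF D(2) assms(2) _ D(12), of "hd d"] adj d(2) D(4) G(2,7) no
      by (simp add: hd_rev hd_append)
  next
    case False
    then obtain e where l: "l = [y, e]"
      using assms(3) G(4) by (cases l; cases "tl l") auto
    have ye: "adj y e" "y \<noteq> e" using D(15) l unfolding vpath_def by auto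
    \<comment> \<open>Stated for every path that begins like \<open>d\<close>, since
      \<open>d\<close> is used both alone and as the start of an end path.\<close>
    have dy: "vpath (rev c @ [y, e])" if c: "vpath c" "set c \<subseteq> R" "hd c = hd d" for c
    proof (rule vpath_append)
      show "vpath (rev c)" using c(1) vpath_rev by blast
      show "vpath [y, e]" using ye by (simp add: vpath_def)
      show "set (rev c) \<inter> set [y, e] = {}" using c(2) D(5) l by auto
      show "adj (last (rev c)) (hd [y, e])"
        using c(1,3) adj unfolding vpath_def by (simp add: last_rev)
    qed
    show ?thesis
    proof (cases "d = a")
      case False
      from end_segments[OF assms(2) D(1) False] show ?thesis
      proof
        \<comment> \<open>Here \<open>a @ q\<close>, reversed, continues through \<open>w\<close>
          into \<open>r\<close>, and \<open>d\<close> alone joins \<open>y, e\<close>.\<close>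
        assume "end_segment a (R - set d)"
        then obtain q where q: "vpath (a @ q)" "2 \<le> length q" "set (a @ q) \<subseteq> R - set d"
          "coverable (R - set d - set (a @ q)) 0" unfolding end_segment_def by blast
        have "vpath (rev (a @ q) @ w # r)"
        proof (rule vpath_append)
          show "vpath (rev (a @ q))" using q(1) vpath_rev by blast
          show "set (rev (a @ q)) \<inter> set (w # r) = {}" using q(3) D(6,7) by auto
          show "adj (last (rev (a @ q))) (hd (w # r))"
            using G(1) D(18) unfolding attachable_def by (simp add: last_rev)
        qed (rule D(13))
        then have "coverable (R - set d \<union> {w} \<union> set r) 0"
          by (rule coverable_add_long[OF q(4)]) (use q(2,3) D(3,6,7) in auto)
        then have "coverable (R \<union> set p) 0"
          by (rule coverable_add_long[OF _ dy[OF d(1,3) refl]]) (use l D(4-10) d(2,3) in \<open>auto simp: Suc_le_eq\<close>)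
        then show ?thesis using no by simp
      next
        \<comment> \<open>Here \<open>d @ q\<close>, reversed, takes up \<open>y, e\<close>, and
          \<open>a\<close> alone takes \<open>w\<close> and \<open>r\<close>.\<close>
        assume "end_segment d (R - set a)"
        then obtain q where q: "vpath (d @ q)" "2 \<le> length q" "set (d @ q) \<subseteq> R - set a"
          "coverable (R - set a - set (d @ q)) 0" unfolding end_segment_def by blast
        have "vpath (rev (d @ q) @ [y, e])" by (rule dy[OF q(1)]) (use q(3) d(2) in auto)
        then have "coverable (R - set a \<union> {y, e}) 0"
          by (rule coverable_add_long[OF q(4)]) (use q(2,3) l D(3,5) in auto)
        then have "coverable (R \<union> set p) 0"
          by (rule coverable_add_long[OF _ D(17)]) (use l D(3-10) G(6) in auto)
        then show ?thesis using no by simp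
      qed
    next
      case True
      note ay = adj[unfolded True]
      show ?thesis
      proof (cases "length r = 2")
        \<comment> \<open>\<open>w # r\<close> is long on its own, so \<open>a\<close> only has to
          absorb \<open>y, e\<close>.\<close>
        case True
        have "coverable (R \<union> {y, e}) 0"
          by (rule coverable_add_long[OF coverable_without[OF assms(2)] dy[OF d(1,3) refl]])
            (use l D(5) d(2,3) in \<open>auto simp: Suc_le_eq\<close>)
        then have "coverable (R \<union> set p) 0"
          by (rule coverable_add_long[OF _ D(13)]) (use l D(4-10) True in auto)
        then show ?thesis using no by simp
      next
        \<comment> \<open>Now \<open>p\<close> has four vertices and the head of \<open>a\<close> is
          adjacent to both inner ones. As \<open>a\<close> is not flippable, it is a single vertex
          \<open>z\<close>, which fits between \<open>y\<close> and \<open>w\<close>.\<close>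
        case False
        then obtain x where r: "r = [x]" using G(3,5) by (cases r; cases "tl r") auto
        have "p = [e, y, w, x] \<or> p = [x, w, y, e]"
          using assms(1) l r unfolding growable_def by auto
        then have "length a \<noteq> 2"
          using G(8) D(2) ay G(1) unfolding flippable_def attachable_def by blast
        then obtain z where a: "a = [z]" using D(18,20) by (cases a; cases "tl a") auto
        have "adj z y" "adj z w" using ay a G(1) unfolding attachable_def by simp_all
        then have "vpath ([e, y] @ [z] @ [w, x])"
          using D(12) a l r D(3,5,6,7) adj_sym[of z y] unfolding vpath_def by auto
        then have "coverable (R \<union> set p) 0"
          by (rule coverable_add_long[OF coverable_without[OF D(1)]]) (use l r a D(3-10) in auto)
        then show ?thesis using no by simp
      qed
    qed
  qed
qed

lemma arm_end_item_not_adj: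
  assumes "growable a p l w r" "d \<in> I" "y \<in> set d"
  shows "\<not> adj (last l) y"
proof
  assume adj: "adj (last l) y"
  note D = attachableD[OF growableD(1)[OF assms(1)]] and G = growableD[OF assms(1)]
  show False
    using coverable_link_item[OF D(2) assms(2,3) D(12)] adj_sym[OF adj] D(4) G(2,7) not_coverable_growable[OF assms(1)]
    by (simp add: hd_rev hd_append)
qed

text \<open>\<open>r\<close> has at most two vertices, so \<open>y\<close> is one of its ends; then
  \<open>a\<close>, \<open>w\<close>, \<open>l\<close> and \<open>r\<close> line up on a single long
  path.\<close>

lemma arm_end_arm_not_adj:
  assumes "growable a p l w r" "y \<in> set r"
  shows "\<not> adj (last l) y"
proof
  assume adj: "adj (last l) y"
  note D = attachableD[OF growableD(1)[OF assms(1)]] and G = growableD[OF assms(1)]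
  have D': "vpath (rev a @ w # l)" using attachableD(17)[OF attachable_sym[OF G(1)]] .
  have "y = hd r \<or> y = last r"
    using assms(2) G(5) by (cases r; cases "tl r") auto
  then obtain c where c: "vpath c" "set c = set r" "hd c = y" "length c = length r"
    using D(16) G(3) vpath_rev[of r] by (metis hd_rev set_rev length_rev)
  have "vpath ((rev a @ w # l) @ c)"
    by (rule vpath_append[OF D' c(1)]) (use c adj G(2) D(3-10) in auto)
  then have "coverable (R \<union> set p) 0"
    by (rule coverable_add_long[OF coverable_without[OF D(1)]]) (use D(3-11) c G(2-7) in auto)
  then show False using not_coverable_growable[OF assms(1)] by simp
qed

text \<open>The arms are reversed so that the head of each new item is an end of \<open>p\<close>,
  whose neighbours the preceding lemmas restrict. One center and two items are gained.\<close>

lemma grow: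
  assumes "growable a p l w r"
  shows "alternating_structure V adj (R \<union> set p) (I \<union> {rev l, rev r}) (insert w S) (F - {p})"
proof -
  note D = attachableD[OF growableD(1)[OF assms]] and G = growableD[OF assms]
  note sym = growable_sym[OF assms]
  have lr: "vpath l" "vpath r" using D(15,16) G(2,3) by blast+
  have disj: "set l \<inter> set b = {}" "set r \<inter> set b = {}" if "b \<in> I" for b
    using D(5,6) item_subset[OF that] by auto
  have ls: "rev l \<notin> I" "rev r \<notin> I" "rev l \<noteq> rev r"
    using disj[of "rev l"] disj[of "rev r"] G(2,3) D(10) by auto
  note rem = path_partition_remove[OF part D(2)]
  have old: "vpath b \<and> length b \<le> 2 \<and> coverable (R \<union> set p - set b) 0" if "b \<in> I" for b
  proof -
    have "coverable (R \<union> set p - set b) 0"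
      by (rule coverable_add_long[OF coverable_without[OF that] F_path[OF D(2)]])
        (use F_disjoint(1)[OF D(2)] item_subset[OF that] D(11) G(7) in auto)
    then show ?thesis using item_path item_length that by blast
  qed
  have head: "x \<in> insert w S \<union> set l" if "growable a p l w r" "x \<in> R \<union> set p" "adj (last l) x" for l r x
    using arm_end_item_not_adj[OF that(1)] arm_end_arm_not_adj[OF that(1)] that(2,3) R_eq
      attachableD(4)[OF growableD(1)[OF that(1)]] by auto
  have leaf: "\<forall>c \<in> I. end_segment (rev l) (R \<union> set p - set c)"
    "\<forall>c \<in> I. end_segment (rev r) (R \<union> set p - set c)"
    "end_segment (rev l) (R \<union> set p - set r)" "end_segment (rev r) (R \<union> set p - set l)"
    using end_segment_arm_item end_segment_arms assms sym by blast+
  show ?thesis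
  proof (unfold_locales, goal_cases)
    case 1
    show ?case using R_subset F_disjoint(2)[OF D(2)] by simp
  next
    case (2 b)
    then show ?case using old lr vpath_rev by blast
  next
    case (3 b)
    then show ?case using old G(4,5) by auto
  next
    case (4 b c)
    then show ?case using disj[of b] disj[of c] D(10) item_disjoint[of b c] by auto
  next
    case 5
    show ?case using R_eq D(4) by auto
  next
    case 6
    show ?case using centers_disjoint R_eq D(5-9) by auto
  next
    case 7
    have "w \<notin> S" using D(7) R_eq by auto
    then show ?case using card_items finite_items finite_centers ls by simp
  next
    case 8
    show ?case using rem(1) by (simp add: Diff_Diff_Int Un_Diff Diff_eq Int_assoc Compl_Un)
  next
    case 9
    show ?case using optimal rem(2) G(7) D(11) by simp
  next
    case (10 b)
    then show ?case using old coverable_without_arm[OF assms] coverable_without_arm[OF sym] by auto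
  next
    case (11 b c)
    then show ?case
      using leaf end_segments end_segment_add_path[OF assms] by (metis UnE insertE singletonD set_rev)
  next
    case (12 b x)
    consider "b \<in> I" | "b = rev l" | "b = rev r" using 12(1) by blast
    then show ?case
    proof cases
      case 1
      then show ?thesis
        using 12(2,3) head_adj old_head_arm_not_adj[OF assms] old_head_arm_not_adj[OF sym] D(4) by blast
    qed (use 12 head[OF assms] head[OF sym] in \<open>simp_all add: hd_rev\<close>)
  next
    case (13 b)
    consider "b = a" | "b \<in> I" "b \<noteq> a" | "b = rev l" | "b = rev r" using 13 by blast
    then show ?case
    proof cases
      \<comment> \<open>Something has now been grown from \<open>a\<close>, but \<open>a\<close> is
        not flippable, and this persists as \<open>F\<close> shrinks.\<close>
      case 1
      then show ?thesis using G(8) unfolding flippable_def by blast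
    next
      case 2
      have "end_segment b (R \<union> set p - set c)" if "\<forall>c\<in>I - {b}. end_segment b (R - set c)"
        "c \<in> I \<union> {rev l, rev r} - {b}" for c
      proof -
        have "end_segment b (R - set a)" using that(1) 2 D(1) by blast
        note * = end_segment_without_arm[OF assms this] end_segment_without_arm[OF sym this]
        show ?thesis using that * end_segment_add_path[OF assms] by auto
      qed
      then show ?thesis using leaf_or_not_flippable[OF 2(1)] unfolding flippable_def by blast
    qed (use leaf in auto)
  qed
qed

section \<open>The blossom step\<close>

text \<open>Edges at \<open>z\<close> and the path itself are recorded in both directions, and
  \<open>p\<close> only by its vertices and length, so that exchanging \<open>x, w\<close> with
  \<open>y, v\<close> is a symmetry. This halves the case analyses below.\<close>

definition flip :: "'a \<Rightarrow> 'a \<Rightarrow> 'a list \<Rightarrow> 'a \<Rightarrow> 'a \<Rightarrow> 'a \<Rightarrow> 'a \<Rightarrow> bool" where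
  "flip z z' p x w v y \<longleftrightarrow> [z, z'] \<in> I \<and> p \<in> F \<and> set p = {x, w, v, y} \<and> length p = 4 \<and>
     vpath [x, w, v, y] \<and> vpath [y, v, w, x] \<and> adj z w \<and> adj w z \<and> adj z v \<and> adj v z \<and>
     (\<forall>d \<in> I - {[z, z']}. end_segment [z, z'] (R - set d))"

lemma flip_sym: "flip z z' p x w v y \<Longrightarrow> flip z z' p y v w x"
  unfolding flip_def by auto

lemma flipD:
  assumes "flip z z' p x w v y"
  shows "[z, z'] \<in> I" "p \<in> F" "set p = {x, w, v, y}" "length p = 4"
    "\<And>d. d \<in> I - {[z, z']} \<Longrightarrow> end_segment [z, z'] (R - set d)"
    "distinct [x, w, v, y, z, z']" "{x, w, v, y} \<inter> R = {}" "z \<in> R" "z' \<in> R"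
    "vpath [x, w, z, v, y]" "vpath [z', z, v, y]" "vpath [x, w, v, y]"
    "adj z w" "adj z v" "adj z z'" "adj z' z" "adj x w" "adj w x" "adj w v"
    "coverable (R - {z, z'}) 0" "\<not> coverable (R \<union> {x, w, v, y}) 0" "vpath [y, v, w, x]"
proof -
  show base: "[z, z'] \<in> I" "p \<in> F" "set p = {x, w, v, y}" "length p = 4"
    "\<And>d. d \<in> I - {[z, z']} \<Longrightarrow> end_segment [z, z'] (R - set d)" "adj z w" "adj z v"
    and p: "vpath [x, w, v, y]" "vpath [y, v, w, x]"
    using assms unfolding flip_def by auto
  have ad: "adj w z" "adj v z" using assms unfolding flip_def by auto
  have a: "vpath [z, z']" using item_path base(1) .
  show R: "z \<in> R" "z' \<in> R" using item_subset[OF base(1)] by auto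
  show pR: "{x, w, v, y} \<inter> R = {}" using F_disjoint(1)[OF base(2)] base(3) by simp
  show dist: "distinct [x, w, v, y, z, z']" using R pR p a unfolding vpath_def by auto
  show zz: "adj z z'" "adj z' z" using a adj_sym unfolding vpath_def by auto
  show "adj x w" "adj w x" "adj w v" using p unfolding vpath_def by auto
  show "vpath [x, w, z, v, y]" "vpath [z', z, v, y]"
    using p dist base(6,7) ad zz unfolding vpath_def by auto
  show "coverable (R - {z, z'}) 0" using coverable_without[OF base(1)] by simp
  show "\<not> coverable (R \<union> {x, w, v, y}) 0"
    using not_coverable_R_Un[OF base(2), of 0] base(3) by simp
qed

text \<open>With \<open>z'\<close> left over, \<open>z\<close> is inserted between \<open>w\<close>
  and \<open>v\<close>; with \<open>x, w\<close> left over, \<open>z', z, v, y\<close> is a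
  path.\<close>

lemma flip_coverable:
  assumes "flip z z' p x w v y"
  shows "coverable (R \<union> {x, w, v, y} - {z'}) 0" "coverable (R \<union> {x, w, v, y} - {x, w}) 0"
proof -
  note D = flipD[OF assms]
  show "coverable (R \<union> {x, w, v, y} - {z'}) 0"
    by (rule coverable_add_long[OF D(20) D(10)]) (use D(6-9) in auto)
  show "coverable (R \<union> {x, w, v, y} - {x, w}) 0"
    by (rule coverable_add_long[OF D(20) D(11)]) (use D(6-9) in auto)
qed

lemma flip_coverable_item:
  assumes "flip z z' p x w v y" "d \<in> I"
  shows "coverable (R \<union> {x, w, v, y} - set d) 0"
proof -
  note D = flipD[OF assms(1)]
  show ?thesis
    by (rule coverable_add_long[OF coverable_without[OF assms(2)] D(12)]) (use D(7) item_subset[OF assms(2)] in auto)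
qed

text \<open>An end path starting with \<open>z, z'\<close> gives up \<open>z\<close> to the path
  \<open>x, w, z, v, y\<close>, and what remains still has at least three vertices. For
  \<open>[x, w]\<close> the continuation is \<open>v, y\<close>.\<close>

lemma flip_end_segment_item:
  assumes "flip z z' p x w v y" "d \<in> I - {[z, z']}"
  shows "end_segment [z'] (R \<union> {x, w, v, y} - set d)" "end_segment [x, w] (R \<union> {x, w, v, y} - set d)"
proof -
  note D = flipD[OF assms(1)]
  have d: "d \<in> I" "set d \<subseteq> R" "set d \<inter> {z, z'} = {}"
    using assms(2) item_subset item_disjoint[OF D(1)] by auto
  obtain q where q: "vpath ([z, z'] @ q)" "2 \<le> length q" "set ([z, z'] @ q) \<subseteq> R - set d"
    "coverable (R - set d - set ([z, z'] @ q)) 0" using D(5)[OF assms(2)] unfolding end_segment_def by blast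
  have q': "vpath ([z'] @ q)" "z \<notin> set q" using q(1) unfolding vpath_def by auto
  have "coverable ((R - set d - set ([z, z'] @ q)) \<union> {x, w, z, v, y}) 0"
    by (rule coverable_add_long[OF q(4) D(10)]) (use D(6-9) in auto)
  then show "end_segment [z'] (R \<union> {x, w, v, y} - set d)"
    by (rule end_segmentI[OF q'(1) q(2)]) (use q(3) q' d D(6-9) in auto)
  show "end_segment [x, w] (R \<union> {x, w, v, y} - set d)"
    by (rule end_segmentI[of _ "[v, y]", OF _ _ coverable_without[OF d(1)]]) (use D(6-9,12) d in auto)
qed

text \<open>The continuation is \<open>z, z'\<close> when \<open>y, v\<close> is left over, and
  \<open>z, v, y\<close> in the other two cases; the rest of the cover is one of \<open>R\<close>
  without \<open>z, z'\<close>.\<close>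

lemma flip_end_segments:
  assumes "flip z z' p x w v y"
  shows "end_segment [x, w] (R \<union> {x, w, v, y} - {y, v})" "end_segment [z'] (R \<union> {x, w, v, y} - {x, w})"
    "end_segment [x, w] (R \<union> {x, w, v, y} - {z'})"
proof -
  note D = flipD[OF assms]
  show "end_segment [x, w] (R \<union> {x, w, v, y} - {y, v})"
    by (rule end_segmentI[of _ "[z, z']", OF _ _ D(20)])
      (use D(6-9,13,15,17) adj_sym[OF D(13)] in \<open>auto simp: vpath_def\<close>)
  show "end_segment [z'] (R \<union> {x, w, v, y} - {x, w})"
    by (rule end_segmentI[of _ "[z, v, y]", OF _ _ D(20)]) (use D(6-9,11) in auto)
  show "end_segment [x, w] (R \<union> {x, w, v, y} - {z'})"
    by (rule end_segmentI[of _ "[z, v, y]", OF _ _ D(20)]) (use D(6-10) in auto)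
qed

text \<open>Leaving over \<open>z'\<close> or \<open>x, w\<close> reduces to leaving over
  \<open>[z, z']\<close> in the old structure, since the other vertices of the blossom form one long
  path.\<close>

lemma flip_end_segment_old:
  assumes "flip z z' p x w v y"
  shows "c \<in> I \<Longrightarrow> end_segment b (R - set c) \<Longrightarrow> end_segment b (R \<union> {x, w, v, y} - set c)"
    "end_segment b (R - {z, z'}) \<Longrightarrow> end_segment b (R \<union> {x, w, v, y} - {z'})"
    "end_segment b (R - {z, z'}) \<Longrightarrow> end_segment b (R \<union> {x, w, v, y} - {x, w})"
proof -
  note D = flipD[OF assms]
  show "end_segment b (R \<union> {x, w, v, y} - set c)" if "c \<in> I" "end_segment b (R - set c)"
    by (rule end_segment_add[OF that(2) coverable_single[OF D(12)]])
      (use D(7) item_subset[OF that(1)] in auto)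
  show "end_segment b (R \<union> {x, w, v, y} - {z'})" if "end_segment b (R - {z, z'})"
    by (rule end_segment_add[OF that coverable_single[OF D(10)]]) (use D(6-9) in auto)
  show "end_segment b (R \<union> {x, w, v, y} - {x, w})" if "end_segment b (R - {z, z'})"
    by (rule end_segment_add[OF that coverable_single[OF D(11)]]) (use D(6-9) in auto)
qed

text \<open>\<open>x\<close> is an end of the path, where \<open>d\<close> could be linked. For
  \<open>w\<close>, the end path starting with \<open>z, z'\<close> is prolonged from
  \<open>z\<close> to \<open>v, y\<close>, while \<open>d\<close> takes \<open>w, x\<close>. The
  vertices \<open>y\<close> and \<open>v\<close> follow by symmetry.\<close>

lemma flip_old_head_not_adj:
  assumes "flip z z' p x w v y" "d \<in> I - {[z, z']}"
  shows "\<not> adj (hd d) x" "\<not> adj (hd d) w"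
proof -
  note D = flipD[OF assms(1)]
  have d: "d \<in> I" "set d \<subseteq> R" "set d \<inter> {z, z'} = {}" "hd d \<in> set d"
    using assms(2) item_subset item_disjoint[OF D(1)] item_path[of d] unfolding vpath_def by auto
  show "\<not> adj (hd d) x"
    using coverable_link_item[OF D(2) d(1,4) D(12)] D(3,21) by auto
  show "\<not> adj (hd d) w"
  proof
    assume adj: "adj (hd d) w"
    obtain q where q: "vpath ([z, z'] @ q)" "2 \<le> length q" "set ([z, z'] @ q) \<subseteq> R - set d"
      "coverable (R - set d - set ([z, z'] @ q)) 0" using D(5)[OF assms(2)] unfolding end_segment_def by blast
    have "vpath (rev ([z, z'] @ q) @ [v, y])"
    proof (rule vpath_append)
      show "vpath (rev ([z, z'] @ q))" using q(1) vpath_rev by blast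
      show "vpath [v, y]" using D(12) unfolding vpath_def by auto
    qed (use q(3) D(7,14) in auto)
    then have vy: "coverable (R - set d \<union> {v, y}) 0"
      by (rule coverable_add_long[OF q(4)]) (use q(3) D(7) in auto)
    have wx: "vpath [w, x]" using D(6,18) unfolding vpath_def by auto
    have "coverable (R \<union> {x, w, v, y}) 0"
    proof (rule coverable_item_extend[OF d(1,4) wx _ _ vy])
      show "adj (hd d) (hd [w, x])" "2 \<le> length [w, x]" using adj by simp_all
      show "set d \<inter> set [w, x] = {}" using D(7) d(2) by auto
      show "(set d \<union> set [w, x]) \<inter> (R - set d \<union> {v, y}) = {}" using D(6,7) d(2) by auto
      show "R \<union> {x, w, v, y} = (R - set d \<union> {v, y}) \<union> set d \<union> set [w, x]" using d(2) by auto
    qed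
    then show False using D(21) by simp
  qed
qed

text \<open>An item \<open>d\<close> adjacent to \<open>z'\<close> could be joined to the end path
  of \<open>z'\<close> that exists when \<open>d\<close> is left over. An edge to \<open>x\<close>
  or \<open>w\<close> would give a path through all six vertices of the blossom.\<close>

lemma flip_mate_not_adj:
  assumes "flip z z' p x w v y"
  shows "d \<in> I - {[z, z']} \<Longrightarrow> u \<in> set d \<Longrightarrow> \<not> adj z' u" "\<not> adj z' x" "\<not> adj z' w"
proof -
  note D = flipD[OF assms]
  show "\<not> adj z' u" if d: "d \<in> I - {[z, z']}" "u \<in> set d"
  proof
    assume adj: "adj z' u"
    obtain q where q: "vpath ([z'] @ q)" "2 \<le> length q" "set ([z'] @ q) \<subseteq> R \<union> {x, w, v, y} - set d"
      "coverable (R \<union> {x, w, v, y} - set d - set ([z'] @ q)) 0"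
      using flip_end_segment_item(1)[OF assms d(1)] unfolding end_segment_def by blast
    have dR: "d \<in> I" "set d \<subseteq> R" using d(1) item_subset by auto
    have "coverable (R \<union> {x, w, v, y}) 0"
    proof (rule coverable_item_extend[OF dR(1) d(2) q(1) _ _ q(4)])
      show "adj u (hd ([z'] @ q))" using adj_sym[OF adj] by simp
      show "2 \<le> length ([z'] @ q)" using q(2) by simp
      show "set d \<inter> set ([z'] @ q) = {}" using q(3) by blast
      show "(set d \<union> set ([z'] @ q)) \<inter> (R \<union> {x, w, v, y} - set d - set ([z'] @ q)) = {}" by blast
      show "R \<union> {x, w, v, y} = (R \<union> {x, w, v, y} - set d - set ([z'] @ q)) \<union> set d \<union> set ([z'] @ q)"
        using q(3) dR(2) by blast
    qed
    then show False using D(21) by simp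
  qed
  \<comment> \<open>\<open>R\<close> without \<open>z, z'\<close> is coverable, so a path through
    the six vertices would complete a forbidden cover.\<close>
  have no: "\<not> vpath s" if "set s = {x, w, v, y, z, z'}" "length s = 6" for s
  proof
    assume "vpath s"
    then have "coverable (R \<union> {x, w, v, y}) 0"
      by (rule coverable_add_long[OF D(20)]) (use that D(6-9) in auto)
    then show False using D(21) by simp
  qed
  show "\<not> adj z' x" "\<not> adj z' w"
    using no[of "[z, z', x, w, v, y]"] no[of "[x, w, z', z, v, y]"] D(6,10,12,15,16) adj_sym[of z' w]
    by (auto simp: vpath_def)
qed

text \<open>\<open>x\<close> is an end of the path, where any item could be linked. An edge to
  \<open>y\<close> or \<open>v\<close> allows a path \<open>z', z, w, x\<close> to go on through the
  two remaining vertices.\<close>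

lemma flip_end_not_adj:
  assumes "flip z z' p x w v y"
  shows "d \<in> I \<Longrightarrow> u \<in> set d \<Longrightarrow> \<not> adj x u" "\<not> adj x y" "\<not> adj x v"
proof -
  note D = flipD[OF assms]
  show "\<not> adj x u" if d: "d \<in> I" "u \<in> set d"
    using coverable_link_item[OF D(2) d D(12)] D(3,21) adj_sym[of x u] by auto
  have no: "\<not> vpath s" if "set s = {x, w, v, y, z, z'}" "length s = 6" for s
  proof
    assume "vpath s"
    then have "coverable (R \<union> {x, w, v, y}) 0"
      by (rule coverable_add_long[OF D(20)]) (use that D(6-9) in auto)
    then show False using D(21) by simp
  qed
  show "\<not> adj x y" "\<not> adj x v"
    using no[of "[z', z, w, x, y, v]"] no[of "[z', z, w, x, v, y]"] D(6,10,13,16,18) D(22)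
    by (auto simp: vpath_def)
qed

text \<open>One item is replaced by three and one center is gained, as the count demands. Every new
  item is an end segment after the removal of any other item, so only pairs of old items rely on the
  former \<open>end_segments\<close>.\<close>

lemma flip_structure:
  assumes "flip z z' p x w v y"
  shows "alternating_structure V adj (R \<union> {x, w, v, y}) (I - {[z, z']} \<union> {[z'], [x, w], [y, v]})
    (insert z S) (F - {p})"
proof -
  note fl = assms flip_sym[OF assms]
  note D = flipD[OF assms]
  let ?J = "I - {[z, z']}" and ?X = "R \<union> {x, w, v, y}"
  have X: "R \<union> {y, v, w, x} = ?X" by auto
  note rem = path_partition_remove[OF part D(2)]
  have disj: "set b \<inter> {x, w, v, y, z, z'} = {}" if "b \<in> ?J" for b
    using D(7) item_subset[of b] item_disjoint[OF D(1), of b] that by auto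
  have new: "[z'] \<notin> ?J" "[x, w] \<notin> ?J" "[y, v] \<notin> ?J"
    using disj[of "[z']"] disj[of "[x, w]"] disj[of "[y, v]"] by auto
  have leaf_mate: "end_segment [z'] (?X - set c)" if "c \<in> ?J \<union> {[x, w], [y, v]}" for c
    using that flip_end_segment_item(1)[OF fl(1)] flip_end_segments(2)[OF fl(1)]
      flip_end_segments(2)[OF fl(2)] X by (auto simp: insert_commute)
  have leaf_xw: "end_segment [x, w] (?X - set c)" if "c \<in> ?J \<union> {[z'], [y, v]}" for c
    using that flip_end_segment_item(2)[OF fl(1)] flip_end_segments(1,3)[OF fl(1)] by auto
  have leaf_yv: "end_segment [y, v] (?X - set c)" if "c \<in> ?J \<union> {[z'], [x, w]}" for c
    using that flip_end_segment_item(2)[OF fl(2)] flip_end_segments(1,3)[OF fl(2)] X by auto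
  show ?thesis
  proof (unfold_locales, goal_cases)
    case 1
    show ?case using R_subset F_disjoint(2)[OF D(2)] D(3) by auto
  next
    case (2 b)
    then show ?case using item_path D(6,10,22) by (auto simp: vpath_def)
  next
    case (3 b)
    then show ?case using item_length by auto
  next
    case (4 b c)
    then show ?case using disj[of b] disj[of c] D(6) item_disjoint[of b c] by auto
  next
    case 5
    have "\<Union>(set ` I) = {z, z'} \<union> \<Union>(set ` ?J)" using D(1) by auto
    then show ?case using R_eq by auto
  next
    case 6
    have "z \<notin> S" "z' \<notin> S" using D(1) centers_disjoint by fastforce+
    then show ?case using centers_disjoint D(6,7) R_eq disj by auto
  next
    case 7
    have "z \<notin> S" using D(1) centers_disjoint by fastforce
    moreover have "card (?J \<union> {[z'], [x, w], [y, v]}) = card ?J + 3"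
      using new finite_items D(6) by (subst card_Un_disjoint) auto
    moreover have "card ?J + 1 = card I" using card_Suc_Diff1[OF finite_items D(1)] by simp
    ultimately show ?case using card_items finite_centers by simp
  next
    case 8
    have "V - ?X = V - R - set p" using D(3) by auto
    then show ?case using rem(1) by simp
  next
    case 9
    show ?case using optimal rem(2) D(4) by simp
  next
    case (10 b)
    then show ?case
      using flip_coverable[OF fl(1)] flip_coverable(2)[OF fl(2), unfolded X] flip_coverable_item[OF fl(1)] by auto
  next
    case (11 b c)
    consider "b \<in> ?J" "c \<in> ?J" | "b \<in> {[z'], [x, w], [y, v]}" | "c \<in> {[z'], [x, w], [y, v]}"
      using 11 by blast
    then show ?case
    proof cases
      case 1
      then show ?thesis using end_segments[of b c] flip_end_segment_old(1)[OF fl(1)] 11(3) by blast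
    next
      case 2
      then have "end_segment b (?X - set c)"
        using 11(2,3) leaf_mate[of c] leaf_xw[of c] leaf_yv[of c] by blast
      then show ?thesis ..
    next
      case 3
      then have "end_segment c (?X - set b)"
        using 11(1,3) leaf_mate[of b] leaf_xw[of b] leaf_yv[of b] by blast
      then show ?thesis ..
    qed
  next
    case (12 b u)
    have u: "u \<in> insert z S \<or> (\<exists>d \<in> ?J. u \<in> set d) \<or> u \<in> {z', x, w, v, y}"
      using 12(2) R_eq by auto
    consider "b \<in> ?J" | "b = [z']" | "b = [x, w]" | "b = [y, v]" using 12(1) by blast
    then show ?case
    proof cases
      case 1
      then show ?thesis
        using 12(2,3) head_adj[of b u] flip_old_head_not_adj[OF fl(1) 1] flip_old_head_not_adj[OF fl(2) 1]
        by auto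
    next
      case 2
      then show ?thesis
        using u 12(3) flip_mate_not_adj[OF fl(1)] flip_mate_not_adj[OF fl(2)] by auto
    next
      \<comment> \<open>The former mate \<open>z'\<close> lies in no item of \<open>?J\<close>; an
        edge from \<open>x\<close> to it is excluded through the old item
        \<open>[z, z']\<close>.\<close>
      case 3
      then show ?thesis
        using u 12(3) flip_end_not_adj[OF fl(1)] flip_end_not_adj(1)[OF fl(1) D(1), of z'] by auto
    next
      case 4
      then show ?thesis
        using u 12(3) flip_end_not_adj[OF fl(2)] flip_end_not_adj(1)[OF fl(2) D(1), of z'] by auto
    qed
  next
    case (13 b)
    show ?case
    proof (cases "b \<in> ?J")
      case True
      have "end_segment b (?X - set c)" if leaf: "\<forall>c\<in>I - {b}. end_segment b (R - set c)"
        and c: "c \<in> ?J \<union> {[z'], [x, w], [y, v]} - {b}" for c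
      proof -
        have "end_segment b (R - {z, z'})" using bspec[OF leaf, of "[z, z']"] D(1) True by auto
        note * = flip_end_segment_old(2,3)[OF fl(1) this] flip_end_segment_old(3)[OF fl(2) this, unfolded X]
        show ?thesis using leaf c * flip_end_segment_old(1)[OF fl(1)] by auto
      qed
      moreover have "\<not> flippable b F \<Longrightarrow> \<not> flippable b (F - {p})"
        unfolding flippable_def by blast
      ultimately show ?thesis using leaf_or_not_flippable[of b] True by blast
    next
      case False
      then have "b = [z'] \<or> b = [x, w] \<or> b = [y, v]" using 13 by blast
      then have "\<forall>c\<in>?J \<union> {[z'], [x, w], [y, v]} - {b}. end_segment b (?X - set c)"
        using leaf_mate leaf_xw leaf_yv by auto
      then show ?thesis ..
    qed
  qed
qed

section \<open>Enlarging a structure that has an outside neighbour\<close>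

lemma extend:
  assumes "a \<in> I" "adj (hd a) w" "w \<in> V - R"
  shows "\<exists>R' I' S' F'. alternating_structure V adj R' I' S' F' \<and> R \<subset> R'"
proof (cases "flippable a F")
  case True
  \<comment> \<open>The blossom need not contain the given outside neighbour, and \<open>w\<close>
    is chosen anew: any strictly larger structure will do.\<close>
  then obtain x w v y where p: "[x, w, v, y] \<in> F" "adj (hd a) w" "adj (hd a) v" "length a = 2"
    unfolding flippable_def by blast
  then obtain z z' where a: "a = [z, z']" by (cases a; cases "tl a") auto
  have "\<forall>d \<in> I - {a}. end_segment a (R - set d)"
    using leaf_or_not_flippable[OF assms(1)] True by blast
  then have flip: "flip z z' [x, w, v, y] x w v y"
    using p a assms(1) F_path[OF p(1)] vpath_rev[of "[x, w, v, y]"] adj_sym unfolding flip_def by auto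
  note flip_structure[OF flip]
  moreover have "R \<subset> R \<union> {x, w, v, y}" using flipD(7)[OF flip] by auto
  ultimately show ?thesis by blast
next
  case False
  obtain p where p: "p \<in> F" "w \<in> set p"
    using part assms(3) unfolding path_partition_def by blast
  then obtain l r where lr: "p = rev l @ w # r" by (metis split_list rev_rev_ident)
  have "growable a p l w r"
    using assms p lr False F_path[OF p(1)] unfolding growable_def attachable_def by auto
  note grow[OF this]
  moreover have "R \<subset> R \<union> set p" using p assms(3) by auto
  ultimately show ?thesis by blast
qed

end

context simple_graph
begin

section \<open>From a minimum path partition to a saturated structure\<close>

lemma path_partition_singletons: "path_partition ((\<lambda>v. [v]) ` V) V"
  using finite_V by (auto simp: path_partition_def vpath_def)

text \<open>In a partition with the fewest short paths, one short path is made the only item, with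
  no centers. The remaining paths then have fewer short ones than the minimum, which gives
  \<open>optimal\<close>.\<close>

lemma initial_alternating_structure:
  assumes "\<not> coverable V 0"
  shows "\<exists>R I S F. alternating_structure V adj R I S F"
proof -
  define k where "k = (LEAST n. coverable V n)"
  have "\<exists>n. coverable V n" unfolding coverable_def using path_partition_singletons by blast
  then have k: "coverable V k" "\<And>n. n < k \<Longrightarrow> \<not> coverable V n"
    unfolding k_def using LeastI_ex not_less_Least by metis+
  then obtain F where F: "path_partition F V" "num_short F \<le> k" unfolding coverable_def by blast
  have "num_short F = k" using F k(2)[of "num_short F"] unfolding coverable_def by fastforce
  moreover have "k > 0" using assms k(1) by (cases k) auto
  ultimately have "{p \<in> F. length p < 3} \<noteq> {}" unfolding num_short_def by (metis card.empty less_irrefl)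
  then obtain p where p: "p \<in> F" "length p < 3" by blast
  note rem = path_partition_remove[OF F(1) p(1)]
  have "num_short (F - {p}) < k" using rem(2) p(2) \<open>num_short F = k\<close> by simp
  then have "\<not> coverable V (num_short (F - {p}))" using k(2) by blast
  moreover have "vpath p" "set p \<subseteq> V" using F(1) p(1) unfolding path_partition_def by auto
  ultimately have "alternating_structure V adj (set p) {p} {} (F - {p})"
    using rem(1) p(2) coverable_empty by unfold_locales auto
  then show ?thesis by blast
qed

text \<open>As long as a head has a neighbour outside \<open>R\<close>, \<open>extend\<close>
  enlarges \<open>R\<close>; neighbours inside \<open>R\<close> are already restricted by
  \<open>head_adj\<close>.\<close>

lemma saturated_alternating_structure:
  assumes "alternating_structure V adj R I S F"
  shows "\<exists>R I S F. alternating_structure V adj R I S F \<and>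
    (\<forall>a\<in>I. \<forall>w\<in>V. adj (hd a) w \<longrightarrow> w \<in> S \<union> set a)"
  using assms
proof (induction "card (V - R)" arbitrary: R I S F rule: less_induct)
  case less
  interpret alternating_structure V adj R I S F by fact
  show ?case
  proof (cases "\<forall>a\<in>I. \<forall>w\<in>V. adj (hd a) w \<longrightarrow> w \<in> S \<union> set a")
    case True
    then show ?thesis using less.prems by blast
  next
    case False
    then obtain a w where "a \<in> I" "adj (hd a) w" "w \<in> V - R" using head_adj by blast
    from extend[OF this] obtain R' I' S' F'
      where R': "alternating_structure V adj R' I' S' F'" "R \<subset> R'" by blast
    have "R' \<subseteq> V" using alternating_structure.R_subset[OF R'(1)] .
    then have "V - R' \<subset> V - R" using R'(2) by auto
    then have "card (V - R') < card (V - R)" using finite_V by (intro psubset_card_mono) auto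
    from less.hyps[OF this R'(1)] show ?thesis .
  qed
qed

section \<open>Double counting between items and centers\<close>

lemma long_path_partition:
  assumes irrefl: "\<And>v. \<not> adj v v"
    and f: "f \<ge> 1"
    and deg: "\<And>v. v \<in> V \<Longrightarrow> f + 1 \<le> card {w \<in> V. adj v w}"
    and star: "\<And>s J. s \<in> V \<Longrightarrow> J \<subseteq> V \<Longrightarrow> (\<And>j. j \<in> J \<Longrightarrow> adj s j) \<Longrightarrow>
      (\<And>i j. i \<in> J \<Longrightarrow> j \<in> J \<Longrightarrow> \<not> adj i j) \<Longrightarrow> card J \<le> 2 * f"
  shows "\<exists>F. path_partition F V \<and> (\<forall>p\<in>F. 3 \<le> length p)"
proof (rule ccontr)
  assume none: "\<not> ?thesis"
  have "\<not> coverable V 0"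
  proof
    assume "coverable V 0"
    then obtain F where F: "path_partition F V" "num_short F = 0" unfolding coverable_def by auto
    then have "{p \<in> F. length p < 3} = {}" unfolding num_short_def path_partition_def by auto
    then show False using none F(1) by (metis (mono_tags, lifting) empty_Collect_eq not_le)
  qed
  then obtain R I S F where st: "alternating_structure V adj R I S F"
    and sat: "\<forall>a\<in>I. \<forall>w\<in>V. adj (hd a) w \<longrightarrow> w \<in> S \<union> set a"
    using initial_alternating_structure saturated_alternating_structure by metis
  interpret alternating_structure V adj R I S F by fact
  have hd: "hd a \<in> set a" "hd a \<in> V" if "a \<in> I" for a
    using item_path[OF that] item_subset[OF that] R_subset hd_in_set[of a] unfolding vpath_def by blast+
  have inj: "inj_on hd I"
  proof (rule inj_onI)
    fix a b assume "a \<in> I" "b \<in> I" "hd a = hd b"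
    then show "a = b" using hd(1)[of a] hd(1)[of b] item_disjoint[of a b] by auto
  qed
  \<comment> \<open>A head has neighbours only in \<open>S\<close> and in its own item; the head of
    another item lies in neither, and loops are excluded.\<close>
  have indep: "\<not> adj (hd a) (hd b)" if "a \<in> I" "b \<in> I" for a b
  proof
    assume "adj (hd a) (hd b)"
    then have "hd b \<in> S \<union> set a" "a \<noteq> b" using sat that hd irrefl by blast+
    then show False using hd(1)[OF that(2)] centers_disjoint item_disjoint[OF that] that by blast
  qed
  \<comment> \<open>The degree bound exceeds \<open>f\<close> by one, which pays for the possible
    mate, the only vertex of \<open>tl a\<close>.\<close>
  have low: "f \<le> card {s \<in> S. adj (hd a) s}" if "a \<in> I" for a
  proof -
    have "{w \<in> V. adj (hd a) w} \<subseteq> {s \<in> S. adj (hd a) s} \<union> set (tl a)"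
    proof
      fix w assume w: "w \<in> {w \<in> V. adj (hd a) w}"
      then have "w \<noteq> hd a" using irrefl by auto
      moreover have "w \<in> S \<union> set a" using w sat that by blast
      moreover have "set a \<subseteq> insert (hd a) (set (tl a))" by (cases a) auto
      ultimately show "w \<in> {s \<in> S. adj (hd a) s} \<union> set (tl a)" using w by blast
    qed
    then have "card {w \<in> V. adj (hd a) w} \<le> card ({s \<in> S. adj (hd a) s} \<union> set (tl a))"
      using finite_centers by (intro card_mono) auto
    also have "\<dots> \<le> card {s \<in> S. adj (hd a) s} + card (set (tl a))" by (rule card_Un_le)
    also have "card (set (tl a)) \<le> 1"
      using card_length[of "tl a"] item_length[OF that] by simp
    finally show ?thesis using deg[OF hd(2)[OF that]] by linarith
  qed
  \<comment> \<open>Distinct items have distinct heads, and heads are pairwise nonadjacent, so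
    \<open>star\<close> bounds the number of items as well.\<close>
  have up: "card {a \<in> I. adj (hd a) s} \<le> 2 * f" if "s \<in> S" for s
  proof -
    have "s \<in> V" using that R_eq R_subset by blast
    then have "card (hd ` {a \<in> I. adj (hd a) s}) \<le> 2 * f"
      by (rule star) (use hd(2) adj_sym indep in auto)
    then show ?thesis using inj by (subst (asm) card_image) (auto intro: inj_on_subset)
  qed
  \<comment> \<open>Counts the pairs of an item and a center adjacent to its head, first by items
    and then by centers.\<close>
  have "card I * f \<le> (\<Sum>a\<in>I. card {s \<in> S. adj (hd a) s})"
    using sum_bounded_below[of I f] low by simp
  also have "\<dots> = (\<Sum>a\<in>I. \<Sum>s\<in>S. if adj (hd a) s then 1 else 0)"
    using finite_centers by (simp add: sum.If_cases Int_def)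
  also have "\<dots> = (\<Sum>s\<in>S. \<Sum>a\<in>I. if adj (hd a) s then 1 else 0)" by (rule sum.swap)
  also have "\<dots> = (\<Sum>s\<in>S. card {a \<in> I. adj (hd a) s})"
    using finite_items by (simp add: sum.If_cases Int_def)
  also have "\<dots> \<le> card S * (2 * f)"
    using sum_bounded_above[of S "\<lambda>s. card {a \<in> I. adj (hd a) s}" "2 * f"] up by simp
  finally have "(2 * card S + 1) * f \<le> card S * (2 * f)" using card_items by simp
  then show False using f by (simp add: algebra_simps)
qed

end

section \<open>Path partitions as path factors\<close>

text \<open>The same set expression as in \<open>path_graph\<close>, so that the two agree after
  unfolding.\<close>

definition path_edges :: "'a list \<Rightarrow> ('a \<times> 'a) set" where
  "path_edges xs = {(xs ! i, xs ! Suc i) | i. Suc i < length xs} \<union>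
     {(xs ! Suc i, xs ! i) | i. Suc i < length xs}"

lemma path_edges_sym: "(u, v) \<in> path_edges xs \<Longrightarrow> (v, u) \<in> path_edges xs"
  unfolding path_edges_def by auto

lemma path_edges_subset: "path_edges xs \<subseteq> set xs \<times> set xs"
  unfolding path_edges_def by auto

lemma path_edges_connected:
  assumes "u \<in> set xs" "v \<in> set xs"
  shows "(u, v) \<in> (path_edges xs)\<^sup>*"
proof -
  have hd: "(xs ! 0, xs ! i) \<in> (path_edges xs)\<^sup>*" if "i < length xs" for i
    using that
  proof (induction i)
    case (Suc i)
    then have "(xs ! i, xs ! Suc i) \<in> path_edges xs" unfolding path_edges_def by blast
    then show ?case using Suc by (simp add: rtrancl_into_rtrancl)
  qed simp
  have "sym ((path_edges xs)\<^sup>*)"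
    by (rule sym_rtrancl) (auto simp: sym_def path_edges_sym)
  then show ?thesis
    using assms hd by (metis in_set_conv_nth rtrancl_trans symE)
qed

section \<open>Spanning subgraphs given by edge sets\<close>

definition edge_subgraph :: "('a, 'b) pre_digraph \<Rightarrow> ('a \<times> 'a) set \<Rightarrow> ('a, 'b) pre_digraph" where
  "edge_subgraph G E = G\<lparr>arcs := {e \<in> arcs G. arc_to_ends G e \<in> E}\<rparr>"

lemma edge_subgraph_simps [simp]:
  "verts (edge_subgraph G E) = verts G" "arcs (edge_subgraph G E) = {e \<in> arcs G. arc_to_ends G e \<in> E}"
  "tail (edge_subgraph G E) = tail G" "head (edge_subgraph G E) = head G"
  by (simp_all add: edge_subgraph_def)

lemma arcs_ends_edge_subgraph: "E \<subseteq> arcs_ends G \<Longrightarrow> arcs_ends (edge_subgraph G E) = E"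
  by (auto simp: arcs_ends_def arc_to_ends_def)

context graph
begin

lemma graph_edge_subgraph:
  assumes "E \<subseteq> arcs_ends G" "sym E"
  shows "graph (edge_subgraph G E)" "spanning (edge_subgraph G E) G"
proof -
  have wf: "wf_digraph (edge_subgraph G E)" by unfold_locales simp_all
  then have sub: "subgraph (edge_subgraph G E) G"
    using wf_digraph by (auto simp: subgraph_def compatible_def)
  then show "spanning (edge_subgraph G E) G" by (simp add: spanning_def)
  show "graph (edge_subgraph G E)"
    by (intro digraph.graphI digraph_subgraph[OF sub])
      (simp add: symmetric_def arcs_ends_edge_subgraph assms)
qed

lemma graph_induce_subgraph:
  assumes "X \<subseteq> verts G"
  shows "graph (G \<restriction> X)"
proof -
  have ind: "induced_subgraph (G \<restriction> X) G" using assms by (rule induced_induce)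
  then have "digraph (G \<restriction> X)" by (intro digraph_subgraph induced_imp_subgraph)
  moreover have "symmetric (G \<restriction> X)" using sym_arcs ind by (rule induced_graph_imp_symmetric)
  ultimately show ?thesis by (rule digraph.graphI)
qed

lemma arcs_ends_induce_subgraph: "arcs_ends (G \<restriction> X) = arcs_ends G \<inter> X \<times> X"
  by (auto simp: arcs_ends_def arc_to_ends_def)

lemma simple_graph: "simple_graph (verts G) (dominates G)"
  by unfold_locales (simp, rule graph_symmetric)

section \<open>Components of a disjoint union of paths\<close>

text \<open>An arc never leaves the path on which it starts, because the paths are disjoint;
  conversely, each path is connected by its own edges.\<close>

lemma scc_of_union_of_paths:
  assumes ends: "arcs_ends G = (\<Union>p\<in>F. path_edges p)"
    and disj: "\<And>p q. p \<in> F \<Longrightarrow> q \<in> F \<Longrightarrow> p \<noteq> q \<Longrightarrow> set p \<inter> set q = {}"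
    and verts: "verts G = \<Union>(set ` F)"
    and p: "p \<in> F" "v \<in> set p"
  shows "scc_of v = set p"
proof (intro equalityI subsetI)
  fix w assume "w \<in> scc_of v"
  then have "v \<rightarrow>\<^sup>* w" unfolding scc_of_def by simp
  then show "w \<in> set p"
  proof (induction rule: reachable_induct)
    case (step x y)
    then obtain q where q: "q \<in> F" "(x, y) \<in> path_edges q" using ends by auto
    then have "x \<in> set q" "y \<in> set q" using path_edges_subset by blast+
    then show ?case using disj[OF q(1) p(1)] step.IH by auto
  qed (use p in simp)
next
  fix w assume w: "w \<in> set p"
  have "(path_edges p)\<^sup>* \<subseteq> (arcs_ends G)\<^sup>*" unfolding ends using p(1) by (intro rtrancl_mono) auto
  then have "(v, w) \<in> (arcs_ends G)\<^sup>*" using path_edges_connected[OF p(2) w] by blast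
  moreover have "v \<in> verts G" using p verts by blast
  ultimately have "v \<rightarrow>\<^sup>* w" by (simp add: reachable_conv')
  then show "w \<in> scc_of v" by (rule scc_ofI_reachable')
qed

text \<open>A component is an induced subgraph on some \<open>set p\<close>. By disjointness its
  arcs stem from \<open>p\<close> alone, so it has no chords.\<close>

lemma sccs_union_of_paths:
  assumes ends: "arcs_ends G = (\<Union>p\<in>F. path_edges p)"
    and disj: "\<And>p q. p \<in> F \<Longrightarrow> q \<in> F \<Longrightarrow> p \<noteq> q \<Longrightarrow> set p \<inter> set q = {}"
    and verts: "verts G = \<Union>(set ` F)"
    and dist: "\<And>p. p \<in> F \<Longrightarrow> p \<noteq> [] \<and> distinct p"
    and C: "C \<in> sccs"
  shows "\<exists>p\<in>F. path_graph C \<and> verts C = set p"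
proof -
  obtain v where v: "v \<in> verts G" "C = G \<restriction> scc_of v"
    using C unfolding sccs_conv_sccs_verts sccs_verts_conv_scc_of by auto
  obtain p where p: "p \<in> F" "v \<in> set p" using v(1) verts by blast
  have C': "C = G \<restriction> set p" using v(2) scc_of_union_of_paths[OF ends disj verts p] by simp
  have "set p \<subseteq> verts G" using p(1) verts by blast
  then have "graph C" unfolding C' by (rule graph_induce_subgraph)
  moreover have "arcs_ends C = path_edges p"
  proof
    show "path_edges p \<subseteq> arcs_ends C"
      unfolding C' arcs_ends_induce_subgraph ends using p(1) path_edges_subset[of p] by blast
    show "arcs_ends C \<subseteq> path_edges p"
    proof (rule subrelI)
      fix x y assume "(x, y) \<in> arcs_ends C"
      then obtain q where q: "q \<in> F" "(x, y) \<in> path_edges q" "x \<in> set p"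
        unfolding C' arcs_ends_induce_subgraph ends by blast
      then have "x \<in> set q" using path_edges_subset by blast
      then show "(x, y) \<in> path_edges p" using disj[OF q(1) p(1)] q(2,3) by auto
    qed
  qed
  moreover have "verts C = set p" unfolding C' by simp
  ultimately have "path_graph C" unfolding path_graph_def path_edges_def using dist[OF p(1)] by blast
  then show ?thesis using p(1) \<open>verts C = set p\<close> by blast
qed

lemma path_factor_of_partition:
  assumes part: "simple_graph.path_partition (dominates G) F (verts G)"
    and long: "\<forall>p\<in>F. k \<le> length p"
  shows "\<exists>H. path_factor k G H"
proof -
  interpret sg: simple_graph "verts G" "dominates G" by (rule simple_graph)
  define E where "E = (\<Union>p\<in>F. path_edges p)"
  have F: "p \<noteq> [] \<and> distinct p" "successively (dominates G) p" if "p \<in> F" for p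
    using part that unfolding sg.path_partition_def sg.vpath_def by auto
  have "path_edges p \<subseteq> arcs_ends G" if "p \<in> F" for p
  proof -
    have "p ! i \<rightarrow> p ! Suc i" if "Suc i < length p" for i
      using F(2)[OF \<open>p \<in> F\<close>] that by (simp add: successively_conv_nth)
    then show ?thesis unfolding path_edges_def using graph_symmetric by blast
  qed
  then have sub: "E \<subseteq> arcs_ends G" unfolding E_def by blast
  have "sym E"
  proof (rule symI)
    fix u v assume "(u, v) \<in> E"
    then obtain p where "p \<in> F" "(u, v) \<in> path_edges p" unfolding E_def by blast
    then show "(v, u) \<in> E" unfolding E_def using path_edges_sym[of u v p] by blast
  qed
  note H = graph_edge_subgraph[OF sub this]
  have "path_graph C \<and> k \<le> card (verts C)" if "C \<in> pre_digraph.sccs (edge_subgraph G E)" for C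
  proof -
    have "\<exists>p\<in>F. path_graph C \<and> verts C = set p"
    proof (rule graph.sccs_union_of_paths[OF H(1) _ _ _ F(1) that])
      show "arcs_ends (edge_subgraph G E) = (\<Union>p\<in>F. path_edges p)"
        using arcs_ends_edge_subgraph[OF sub] E_def by simp
      show "set p \<inter> set q = {}" if "p \<in> F" "q \<in> F" "p \<noteq> q" for p q
        using part that unfolding sg.path_partition_def by simp
      show "verts (edge_subgraph G E) = \<Union>(set ` F)"
        using part unfolding sg.path_partition_def by simp
    qed
    then obtain p where "p \<in> F" "path_graph C" "verts C = set p" by blast
    then show ?thesis using long F(1)[of p] distinct_card[of p] by simp
  qed
  then show ?thesis using H unfolding path_factor_def by blast
qed

section \<open>Degrees and induced stars\<close>

text \<open>Without parallel arcs, \<open>head G\<close> is injective on the arcs leaving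
  \<open>v\<close>.\<close>

lemma out_degree_conv: "out_degree G v = card {w \<in> verts G. v \<rightarrow> w}"
proof -
  have "{w \<in> verts G. v \<rightarrow> w} = head G ` out_arcs G v"
    by (auto simp: arcs_ends_conv)
  moreover have "inj_on (head G) (out_arcs G v)"
    using no_multi_arcs by (auto simp: inj_on_def arc_to_ends_def)
  ultimately show ?thesis unfolding out_degree_def by (simp add: card_image)
qed

text \<open>Exactly \<open>r\<close> of these neighbours, together with \<open>s\<close>, would
  induce the forbidden star.\<close>

lemma star_free_independent_neighbours:
  assumes "star_free r G" "s \<in> verts G" "J \<subseteq> verts G"
    and "\<And>j. j \<in> J \<Longrightarrow> s \<rightarrow> j" "\<And>i j. i \<in> J \<Longrightarrow> j \<in> J \<Longrightarrow> \<not> i \<rightarrow> j"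
  shows "card J < r"
proof (rule ccontr)
  assume "\<not> card J < r"
  then obtain L where L: "L \<subseteq> J" "card L = r" "finite L"
    by (metis not_less obtain_subset_with_card_n)
  have s: "s \<notin> L" "\<not> s \<rightarrow> s" using assms(4) L(1) adj_not_same by blast+
  have sub: "insert s L \<subseteq> verts G" using assms(2,3) L(1) by auto
  have "arcs_ends (G \<restriction> insert s L) = {s} \<times> L \<union> L \<times> {s}"
    unfolding arcs_ends_induce_subgraph using assms(4,5) L(1) s graph_symmetric by blast
  moreover have "verts (G \<restriction> insert s L) = {s} \<union> L" "{s} \<inter> L = {}" "card {s} = 1"
    using s(1) by simp_all
  ultimately have "K\<^bsub>1,r\<^esub> (G \<restriction> insert s L)"
    unfolding complete_bipartite_digraph_def using graph_induce_subgraph[OF sub] L(2) by blast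
  then show False using assms(1) induced_induce[OF sub] unfolding star_free_def by blast
qed

end

theorem theorem5:
  fixes r :: nat and G :: "('a,'b) pre_digraph"
  assumes "r \<ge> 3"
    and "graph G"
    and "star_free r G"
    and "min_degree G \<ge> r div 2 + 1"
  shows "\<exists>F. path_factor 3 G F"
proof -
  interpret graph G by fact
  interpret sg: simple_graph "verts G" "dominates G" by (rule simple_graph)
  have "\<exists>F. sg.path_partition F (verts G) \<and> (\<forall>p\<in>F. 3 \<le> length p)"
  proof (rule sg.long_path_partition[where f = "r div 2"])
    show "r div 2 + 1 \<le> card {w \<in> verts G. v \<rightarrow>\<^bsub>G\<^esub> w}" if "v \<in> verts G" for v
    proof -
      have "min_degree G \<le> out_degree G v" unfolding min_degree_def using that by simp
      then show ?thesis using assms(4) out_degree_conv by simp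
    qed
    show "card J \<le> 2 * (r div 2)"
      if "s \<in> verts G" "J \<subseteq> verts G" "\<And>j. j \<in> J \<Longrightarrow> s \<rightarrow>\<^bsub>G\<^esub> j"
        "\<And>i j. i \<in> J \<Longrightarrow> j \<in> J \<Longrightarrow> \<not> i \<rightarrow>\<^bsub>G\<^esub> j" for s J
    proof -
      have "card J < r" using star_free_independent_neighbours[OF assms(3) that] .
      \<comment> \<open>For odd \<open>r\<close> this is an equality, for even \<open>r\<close>
        there is one to spare; so both parities admit at most \<open>2 * (r div 2)\<close>
        independent neighbours.\<close>
      moreover have "r \<le> 2 * (r div 2) + 1" by presburger
      ultimately show ?thesis by linarith
    qed
  qed (use assms(1) adj_not_same in auto)
  then show ?thesis using path_factor_of_partition by blast
qed

end
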